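(* The exponential generating function $\mathsf{L}(t)=\sum_{n=0}^\infty \mathcal{L}_n\frac{t^n}{n!}$ of the Lucas-Fubini numbers is given by $$\mathsf{L}(t)= \alpha e^{\left(e^{t}-1\right)\alpha}+\beta e^{\left(e^{t}-1\right)\beta}.$$
   Context: $\alpha=(1+\sqrt5)/2$ and $\beta=(1-\sqrt5)/2$. The identity is one of formal power series in $t$. ${n\brace k}$ denotes the Stirling number of the second kind (the number of partitions of an $n$-element set into exactly $k$ non-empty blocks). $L_m$ denotes the Lucas numbers: $L_0=2$, $L_1=1$, $L_m=L_{m-1}+L_{m-2}$ for $m\ge2$. The Lucas-Fubini numbers are defined by $\mathcal{L}_n=\sum_{k=0}^n L_{k+1}{n\brace k}$ for $n\ge0$. *)

theory Defs
  imports
    "HOL-Combinatorics.Stirling"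
    "HOL-Library.Disjoint_Sets"
    "HOL-Computational_Algebra.Formal_Power_Series"
begin

text \<open>The library defines \<^const>\<open>Stirling\<close> by its recurrence only; the following shows
  that it counts the partitions of a finite set into a given number of non-empty blocks.\<close>

lemma card_partition_on_eq_Stirling:
  assumes "finite A"
  shows "card {P. partition_on A P \<and> card P = k} = Stirling (card A) k"
  using assms
proof (induction A arbitrary: k rule: finite_induct)
  case empty
  show ?case
  proof (cases k)
    case 0
    then have "{P. partition_on ({} :: 'a set) P \<and> card P = k} = {{}}"
      by (auto simp: partition_on_empty)
    with 0 show ?thesis by simp
  next
    case (Suc m)
    then have "{P. partition_on ({} :: 'a set) P \<and> card P = k} = {}"
      by (auto simp: partition_on_empty)
    with Suc show ?thesis by (simp only: card.empty Stirling.simps)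
  qed
next
  case (insert a A)
  let ?S = "\<lambda>X k. {P. partition_on X P \<and> card P = k}"
  have fin: "finite (?S X k)" if "finite X" for X :: "'a set" and k
  proof (rule finite_subset)
    show "?S X k \<subseteq> Pow (Pow X)" by (auto simp: partition_on_def)
  qed (use that in simp)
  have finP: "finite P" if "partition_on X P" "finite X" for X :: "'a set" and P
    using that finite_elements by blast
  show ?case
  proof (cases k)
    case 0
    have "?S (insert a A) 0 = {}"
    proof -
      have False if P: "partition_on (insert a A) P" and c: "card P = 0" for P
      proof -
        have "finite P" using finP[OF P] insert.hyps by simp
        then have "P = {}" using c by simp
        then show False using P by (simp add: partition_on_def)
      qed
      then show ?thesis by blast
    qed
    moreover have "Stirling (card (insert a A)) 0 = 0" using insert.hyps by simp
    ultimately show ?thesis by (simp only: 0 card.empty)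
  next
    case (Suc m)
    let ?f = "\<lambda>P. insert {a} P"
    let ?g = "\<lambda>(P, B). insert (insert a B) (P - {B})"
    let ?X = "?f ` ?S A m"
    let ?T = "SIGMA P : ?S A (Suc m). P"
    let ?Y = "?g ` ?T"
    have na: "B \<subseteq> A" "a \<notin> B" "B \<noteq> {}" if "partition_on A P" "B \<in> P" for P B
      using that insert.hyps by (auto simp: partition_on_def)
    have eq: "?S (insert a A) (Suc m) = ?X \<union> ?Y"
    proof (intro equalityI subsetI)
      fix P assume P: "P \<in> ?S (insert a A) (Suc m)"
      then have pP: "partition_on (insert a A) P" and cP: "card P = Suc m" by auto
      have fP: "finite P" using finP[OF pP] insert.hyps by simp
      obtain C where C: "C \<in> P" "a \<in> C" using pP by (auto simp: partition_on_def)
      have dis: "D \<inter> E = {}" if "D \<in> P" "E \<in> P" "D \<noteq> E" for D E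
        using pP that by (auto simp: partition_on_def disjoint_def)
      have noa: "a \<notin> D" if "D \<in> P - {C}" for D using dis[of C D] that C by auto
      have UP: "\<Union>P = insert a A" and ne: "{} \<notin> P" using pP by (auto simp: partition_on_def)
      show "P \<in> ?X \<union> ?Y"
      proof (cases "C = {a}")
        case True
        have un: "\<Union>(P - {{a}}) = A"
        proof -
          have "P = insert {a} (P - {{a}})" using C True by blast
          then have "insert a (\<Union>(P - {{a}})) = insert a A" using UP by (metis Union_insert insert_is_Un)
          moreover have "a \<notin> \<Union>(P - {{a}})" using noa True by blast
          ultimately show ?thesis using insert.hyps by (simp add: insert_ident)
        qed
        have "disjoint (P - {{a}})" using dis by (auto simp: disjoint_def)
        then have "partition_on A (P - {{a}})" using un ne by (auto simp: partition_on_def)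
        moreover have "card (P - {{a}}) = m" using cP C True fP by simp
        ultimately have "P - {{a}} \<in> ?S A m" by simp
        moreover have "P = ?f (P - {{a}})" using C True by auto
        ultimately show ?thesis by blast
      next
        case False
        let ?B = "C - {a}" let ?Q = "insert ?B (P - {C})"
        have Bne: "?B \<noteq> {}" using False C by auto
        have Bn: "?B \<notin> P - {C}" using dis[of ?B C] Bne C by auto
        have "\<Union>?Q = A"
        proof -
          have "P = insert C (P - {C})" using C by blast
          then have "C \<union> \<Union>(P - {C}) = insert a A" using UP by (metis Union_insert)
          then have "insert a (\<Union>?Q) = insert a A" using C by auto
          moreover have "a \<notin> \<Union>?Q" using noa by blast
          ultimately show ?thesis using insert.hyps by (simp add: insert_ident)
        qed
        moreover have "disjoint ?Q"
        proof (rule disjointI)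
          fix D E assume "D \<in> ?Q" "E \<in> ?Q" "D \<noteq> E"
          then consider "D \<in> P" "E \<in> P" | "D = ?B" "E \<in> P" "E \<noteq> C" | "E = ?B" "D \<in> P" "D \<noteq> C"
            by blast
          then show "D \<inter> E = {}"
          proof cases
            case 1 then show ?thesis using dis \<open>D \<noteq> E\<close> by blast
          next
            case 2 then show ?thesis using dis[of C E] C by blast
          next
            case 3 then show ?thesis using dis[of C D] C by blast
          qed
        qed
        ultimately have "partition_on A ?Q" using ne Bne by (auto simp: partition_on_def)
        moreover have "card ?Q = Suc m" using Bn cP C fP by simp
        ultimately have "(?Q, ?B) \<in> ?T" by simp
        moreover have "P = ?g (?Q, ?B)"
        proof -
          have "insert a ?B = C" using C by auto
          moreover have "?Q - {?B} = P - {C}" using Bn by auto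
          ultimately show ?thesis using C by auto
        qed
        ultimately show ?thesis by blast
      qed
    next
      fix P assume "P \<in> ?X \<union> ?Y"
      then show "P \<in> ?S (insert a A) (Suc m)"
      proof
        assume "P \<in> ?X"
        then obtain Q where Q: "partition_on A Q" "card Q = m" "P = insert {a} Q" by auto
        have "{a} \<notin> Q" using na[OF Q(1)] by auto
        moreover have "partition_on (insert a A) P"
        proof -
          have U: "\<Union>Q = A" using Q by (simp add: partition_on_def)
          then have "disjnt {a} (\<Union>Q)" using insert.hyps by simp
          moreover have "insert a A - {a} = A" using insert.hyps by simp
          ultimately show ?thesis using Q by (simp add: partition_on_insert)
        qed
        ultimately show ?thesis using Q finP[OF Q(1)] insert.hyps by simp
      next
        assume "P \<in> ?Y"
        then obtain Q B where Q: "partition_on A Q" "card Q = Suc m" "B \<in> Q"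
          "P = insert (insert a B) (Q - {B})" by auto
        have fQ: "finite Q" using finP[OF Q(1)] insert.hyps by simp
        have n: "insert a B \<notin> Q - {B}" using na[OF Q(1)] by blast
        have dis: "D \<inter> E = {}" if "D \<in> Q" "E \<in> Q" "D \<noteq> E" for D E
          using Q that by (auto simp: partition_on_def disjoint_def)
        have "\<Union>P = insert a A" using Q by (auto simp: partition_on_def)
        moreover have "disjoint P"
        proof (rule disjointI)
          fix D E assume "D \<in> P" "E \<in> P" "D \<noteq> E"
          then consider "D \<in> Q" "E \<in> Q" | "D = insert a B" "E \<in> Q" "E \<noteq> B"
            | "E = insert a B" "D \<in> Q" "D \<noteq> B"
            using Q(4) by blast
          then show "D \<inter> E = {}"
          proof cases
            case 1 then show ?thesis using dis \<open>D \<noteq> E\<close> by blast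
          next
            case 2 then show ?thesis using dis[of B E] Q(3) na(2)[OF Q(1)] by blast
          next
            case 3 then show ?thesis using dis[of B D] Q(3) na(2)[OF Q(1)] by blast
          qed
        qed
        moreover have "{} \<notin> P" using Q by (auto simp: partition_on_def)
        ultimately have "partition_on (insert a A) P" by (auto simp: partition_on_def)
        moreover have "card P = Suc m" using Q n fQ by simp
        ultimately show ?thesis by simp
      qed
    qed
    have disj: "?X \<inter> ?Y = {}"
    proof (rule ccontr)
      assume "?X \<inter> ?Y \<noteq> {}"
      then obtain P where P: "P \<in> ?X" "P \<in> ?Y" by blast
      from P(1) have aP: "{a} \<in> P" by blast
      from P(2) obtain Q B where Q: "P = insert (insert a B) (Q - {B})" "partition_on A Q" "B \<in> Q"
        by auto
      have "{a} = insert a B \<or> {a} \<in> Q" using aP Q(1) by auto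
      moreover have "{a} \<notin> Q" using na(2)[OF Q(2)] by blast
      ultimately have "B \<subseteq> {a}" by auto
      then show False using na(2,3)[OF Q(2,3)] by blast
    qed
    have injf: "inj_on ?f (?S A m)"
    proof (rule inj_onI)
      fix P Q assume "P \<in> ?S A m" "Q \<in> ?S A m" and e: "?f P = ?f Q"
      then have "{a} \<notin> P" "{a} \<notin> Q" using na(2) by blast+
      then show "P = Q" using e by (simp add: insert_ident)
    qed
    have injg: "inj_on ?g ?T"
    proof (rule inj_onI, clarify)
      fix P B Q C
      assume P: "partition_on A P" "B \<in> P" and Q: "partition_on A Q" "C \<in> Q"
        and e: "insert (insert a B) (P - {B}) = insert (insert a C) (Q - {C})"
      have "insert a B \<in> insert (insert a C) (Q - {C})" using e by blast
      then have "insert a B = insert a C" using na(2)[OF Q(1)] by blast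
      then have BC: "B = C" using na(2)[OF P] na(2)[OF Q] by (simp add: insert_ident)
      have "insert a B \<notin> P - {B}" "insert a B \<notin> Q - {B}"
        using na(2)[OF P(1)] na(2)[OF Q(1)] by blast+
      then have "P - {B} = Q - {B}" using e BC by (simp add: insert_ident)
      then show "P = Q \<and> B = C" using BC P Q by blast
    qed
    have finT: "finite ?T" using fin[of A "Suc m"] finP insert.hyps by (intro finite_SigmaI) auto
    have "card ?T = (\<Sum>P\<in>?S A (Suc m). card P)"
      using fin[of A "Suc m"] finP insert.hyps by (intro card_SigmaI) auto
    also have "\<dots> = Suc m * Stirling (card A) (Suc m)"
      by (simp add: insert.IH)
    finally have "card ?Y = Suc m * Stirling (card A) (Suc m)"
      using card_image[OF injg] by simp
    moreover have "card ?X = Stirling (card A) m"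
      using card_image[OF injf] insert.IH by simp
    moreover have "card (?S (insert a A) (Suc m)) = card ?X + card ?Y"
      unfolding eq using disj fin[of A m] finT insert.hyps by (intro card_Un_disjoint) auto
    ultimately show ?thesis using Suc insert.hyps by simp
  qed
qed

fun lucas_number :: "nat \<Rightarrow> nat" where
  "lucas_number 0 = 2"
| "lucas_number (Suc 0) = 1"
| "lucas_number (Suc (Suc m)) = lucas_number (Suc m) + lucas_number m"

definition lucas_fubini :: "nat \<Rightarrow> nat" where
  "lucas_fubini n = (\<Sum>k=0..n. lucas_number (k + 1) * Stirling n k)"

definition egf :: "(nat \<Rightarrow> real) \<Rightarrow> real fps" where
  "egf a = Abs_fps (\<lambda>n. a n / fact n)"

end

theory Submission
  imports Defs
begin

text \<open>The power \<open>(e\<^sup>t - 1)\<^sup>k\<close> has derivative \<open>k ((e\<^sup>t - 1)\<^sup>k + (e\<^sup>t - 1)\<^sup>k\<^sup>-\<^sup>1)\<close>, so the numbers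
  \<open>n! [t\<^sup>n] (e\<^sup>t - 1)\<^sup>k / k!\<close> satisfy the recurrence of the Stirling numbers. Hence
  \<open>n! [t\<^sup>n] exp (c (e\<^sup>t - 1))\<close> is the sum of the \<open>c\<^sup>k Stirling n k\<close>, and
  Binet's formula \<open>L\<^sub>m = \<alpha>\<^sup>m + \<beta>\<^sup>m\<close> finishes the proof.\<close>

unbundle fps_syntax

lemma fps_exp_minus_one_power_nth:
  "((fps_exp 1 - 1) ^ k :: 'a::field_char_0 fps) $ n =
    fact k * of_nat (Stirling n k) / fact n"
proof (induction n arbitrary: k)
  case 0
  show ?case by (cases k) (auto simp: fps_nth_power_0)
next
  case (Suc n)
  show ?case
  proof (cases k)
    case 0
    then show ?thesis by simp
  next
    case (Suc m)
    let ?E = "fps_exp 1 - 1 :: 'a fps"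
    \<comment> \<open>The chain rule leaves a factor \<open>fps_exp 1\<close>, which is
      \<open>?E + 1\<close>.\<close>
    have "fps_deriv (?E ^ Suc m) = of_nat (Suc m) * (?E ^ Suc m + ?E ^ m)"
      by (subst fps_deriv_power) (simp add: algebra_simps fps_of_nat del: of_nat_Suc)
    then have "fps_deriv (?E ^ Suc m) $ n = of_nat (Suc m) * (?E ^ Suc m $ n + ?E ^ m $ n)"
      by (metis fps_add_nth fps_mult_left_const_nth fps_of_nat)
    then have "of_nat (Suc n) * ?E ^ Suc m $ Suc n
        = of_nat (Suc m) * (?E ^ Suc m $ n + ?E ^ m $ n)"
      by (simp only: fps_deriv_nth Suc_eq_plus1)
    \<comment> \<open>With \<open>fact (Suc m)\<close> factored out,
      \<open>Suc m * Stirling n (Suc m) + Stirling n m\<close> remains.\<close>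
    also have "\<dots> = fact (Suc m) * of_nat (Stirling (Suc n) (Suc m)) / fact n"
      by (simp only: Suc.IH Stirling.simps fact_Suc of_nat_add of_nat_mult add_divide_distrib
          distrib_left times_divide_eq_right mult.assoc mult.commute mult.left_commute)
    finally show ?thesis
      using Suc by (simp add: field_simps del: of_nat_Suc Stirling.simps power_Suc)
  qed
qed

text \<open>The coefficient 1/k! of the outer exponential cancels the \<open>fact k\<close> in the
  coefficients of the k-th power.\<close>

lemma fps_exp_compose_exp_minus_one_nth:
  "(fps_exp 1 oo ((fps_exp 1 - 1) * fps_const c)) $ n =
    (\<Sum>k=0..n. c ^ k * of_nat (Stirling n k)) / (fact n :: 'a::field_char_0)"
  by (simp add: fps_compose_nth power_mult_distrib fps_const_power fps_exp_minus_one_power_nth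
      sum_divide_distrib mult.commute)

lemma lucas_number_Binet:
  "real (lucas_number m) = ((1 + sqrt 5) / 2) ^ m + ((1 - sqrt 5) / 2) ^ m"
proof (induction m rule: lucas_number.induct)
  case (3 m)
  \<comment> \<open>Both bases are roots of x^2 = x + 1, so their powers obey the Lucas
    recurrence.\<close>
  have rec: "x ^ Suc (Suc m) = x ^ Suc m + x ^ m" if "x\<^sup>2 = x + 1" for x :: real
    using that by (metis distrib_left mult.right_neutral power_Suc2 power_add power2_eq_square
        add_2_eq_Suc')
  have "((1 + sqrt 5) / 2)\<^sup>2 = (1 + sqrt 5) / 2 + 1" "((1 - sqrt 5) / 2)\<^sup>2 = (1 - sqrt 5) / 2 + 1"
    by (simp_all add: power2_eq_square field_simps)
  from this[THEN rec] "3.IH" show ?case by (simp del: power_Suc)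
qed (simp_all add: field_simps)

theorem theorem4:
  fixes \<alpha> \<beta> :: real
  assumes "\<alpha> = (1 + sqrt 5) / 2" and "\<beta> = (1 - sqrt 5) / 2"
  shows "egf (\<lambda>n. real (lucas_fubini n)) =
    fps_const \<alpha> * (fps_exp 1 oo ((fps_exp 1 - 1) * fps_const \<alpha>)) +
    fps_const \<beta> * (fps_exp 1 oo ((fps_exp 1 - 1) * fps_const \<beta>))"
proof (rule fps_ext)
  fix n
  \<comment> \<open>The index shift in \<open>lucas_number (k + 1)\<close> produces the prefactors
    \<open>\<alpha>\<close> and \<open>\<beta>\<close>.\<close>
  have "real (lucas_fubini n) =
      \<alpha> * (\<Sum>k=0..n. \<alpha> ^ k * real (Stirling n k)) + \<beta> * (\<Sum>k=0..n. \<beta> ^ k * real (Stirling n k))"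
    unfolding lucas_fubini_def assms
    by (simp add: lucas_number_Binet sum_distrib_left sum.distrib[symmetric] distrib_right mult.assoc)
  then show "egf (\<lambda>n. real (lucas_fubini n)) $ n =
      (fps_const \<alpha> * (fps_exp 1 oo ((fps_exp 1 - 1) * fps_const \<alpha>)) +
      fps_const \<beta> * (fps_exp 1 oo ((fps_exp 1 - 1) * fps_const \<beta>))) $ n"
    by (simp add: egf_def fps_exp_compose_exp_minus_one_nth add_divide_distrib)
qed

end
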